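(* The following coefficients can be used to construct the corresponding valid inequalities. (1) Let $$\hat\rho=\max\{\phi(z)-\phi(z') : z,z'\in\{0,1\}^{n_x},\ \|z-z'\|_2^2=1\}.$$ Then $\hat\rho$ is sufficiently large for the penalty-based inequality: $\phi(x)=L_p(x,\rho)$ for all $x\in\{0,1\}^{n_x}$ and all $\rho\ge\hat\rho$, and hence for each $z\in\{0,1\}^{n_x}$ the inequality $d_\ell^\top y\ge\phi(z)-\hat\rho(\mathbf 1^\top x+\mathbf 1^\top z-2x^\top z)$ is valid and tight for $d_\ell^\top y\ge\phi(x)$. (2) For all $i\in[n_x]$ let $$L_i=\min\{\phi(z)-\phi(z')\},\qquad U_i=\max\{\phi(z)-\phi(z')\},$$ both over $z,z'\in\{0,1\}^{n_x}$ with $z_{-i}=z'_{-i}$, $z_i=0$, $z'_i=1$. Then $U$ and $L$ are sufficiently large and sufficiently small, respectively, for the Lagrangian-based inequality: $\phi(x)=L_\ell(x,\lambda)$ for all $x\in\{0,1\}^{n_x}$ and all $\lambda$ with $\lambda_i\ge U_i$ if $x_i=1$ and $\lambda_i\le L_i$ if $x_i=0$, and hence for each $z\in\{0,1\}^{n_x}$ the inequality $d_\ell^\top y\ge\phi(z)-\hat\lambda(z)^\top(x-z)$ is valid and tight for $d_\ell^\top y\ge\phi(x)$. (3) Let $\hat\rho\ge0$ be arbitrary, and for all $i\in[n_x]$ let $$L_i=\hat\rho+\min\{\phi(z)-\phi(z')\},\qquad U_i=-\hat\rho+\max\{\phi(z)-\phi(z')\},$$ both over $z,z'\in\{0,1\}^{n_x}$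 with $z_{-i}=z'_{-i}$, $z_i=0$, $z'_i=1$. Then these coefficients are sufficient for the augmented Lagrangian-based inequality: $\phi(x)=L_a(x,\lambda,\rho)$ for all $x\in\{0,1\}^{n_x}$, all $\rho\ge\hat\rho$ and all $\lambda$ with $\lambda_i\ge U_i$ if $x_i=1$ and $\lambda_i\le L_i$ if $x_i=0$, and hence for each $z\in\{0,1\}^{n_x}$ the inequality $d_\ell^\top y\ge\phi(z)-\hat\lambda(z)^\top(x-z)-\hat\rho(\mathbf 1^\top x+\mathbf 1^\top z-2x^\top z)$ is valid and tight for $d_\ell^\top y\ge\phi(x)$.
   Context: $\phi:\{0,1\}^{n_x}\to\mathbb{R}$ is the (real-valued) value function $\phi(x)=\max\{d_\ell^\top y' : y'\in Y,\ B_\ell y'\le h_\ell-A_\ell x\}$, where $Y\subseteq\mathbb{R}^{n_y}$ and $d_\ell,A_\ell,B_\ell,h_\ell$ are real data of compatible dimensions. $\psi:[0,1]^{n_x}\to\mathbb{R}$ is the extension of $\phi$ that is affine in each individual coordinate, $\psi(z)=\sum_{x\in\{0,1\}^{n_x}}\phi(x)\prod_{i:x_i=1}z_i\prod_{i:x_i=0}(1-z_i)$. $\mathbf 1$ is the all-ones vector, $\odot$ the entrywise product, $[n]=\{1,\dots,n\}$, and $z_{-i}$ is $z$ with entry $i$ removed. $\hat\lambda(z):=U\odot(\mathbf 1-z)+L\odot z$ (with the $U,L$ of the respective item). $L_p(x,\rho)=\max_{z\in[0,1]^{n_x}}\psi(z)-\rho(\mathbf 1^\top x+\mathbf 1^\top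 z-2x^\top z)$; $L_\ell(x,\lambda)=\max_{z\in[0,1]^{n_x}}\psi(z)-\lambda^\top(x-z)$; $L_a(x,\lambda,\rho)=\max_{z\in[0,1]^{n_x}}\psi(z)-\lambda^\top(x-z)-\rho(\mathbf 1^\top x+\mathbf 1^\top z-2x^\top z)$; here $\lambda\in\mathbb{R}^{n_x}$, $\rho\ge0$. An inequality $d_\ell^\top y\ge r(x)$ is "valid and tight" for $d_\ell^\top y\ge\phi(x)$ if $r(x)\le\phi(x)$ for all $x\in\{0,1\}^{n_x}$ with equality for some $x\in\{0,1\}^{n_x}$ (for the inequalities above, at $x=z$). *)

theory Defs
  imports "HOL-Analysis.Analysis"
begin

(* On vectors, 1 is the all-ones vector, * the entrywise product, <= the entrywise order,
   \<bullet> the inner product, and cbox 0 1 the unit cube. *)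

definition binary_cube :: "(real ^ 'n) set" where
  "binary_cube = {x. \<forall>i. x $ i = 0 \<or> x $ i = 1}"

definition feasible ::
  "(real ^ 'y) set \<Rightarrow> real ^ 'n ^ 'm \<Rightarrow> real ^ 'y ^ 'm \<Rightarrow> real ^ 'm \<Rightarrow> real ^ 'n \<Rightarrow> (real ^ 'y) set" where
  "feasible Y A B h x = {y \<in> Y. B *v y \<le> h - A *v x}"

(* GREATEST denotes the attained maximum and is unspecified if there is none. *)

definition value_fn ::
  "(real ^ 'y) set \<Rightarrow> real ^ 'y \<Rightarrow> real ^ 'n ^ 'm \<Rightarrow> real ^ 'y ^ 'm \<Rightarrow> real ^ 'm \<Rightarrow> real ^ 'n \<Rightarrow> real" where
  "value_fn Y d A B h x = (GREATEST v. \<exists>y \<in> feasible Y A B h x. v = d \<bullet> y)"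

definition real_valued_value_fn ::
  "(real ^ 'y) set \<Rightarrow> real ^ 'y \<Rightarrow> real ^ 'n ^ 'm \<Rightarrow> real ^ 'y ^ 'm \<Rightarrow> real ^ 'm \<Rightarrow> bool" where
  "real_valued_value_fn Y d A B h \<longleftrightarrow>
     (\<forall>x \<in> binary_cube. \<exists>y \<in> feasible Y A B h x. \<forall>y' \<in> feasible Y A B h x. d \<bullet> y' \<le> d \<bullet> y)"

definition psi :: "(real ^ 'n \<Rightarrow> real) \<Rightarrow> real ^ 'n \<Rightarrow> real" where
  "psi \<phi> z = (\<Sum>x\<in>binary_cube. \<phi> x * (\<Prod>i | x $ i = 1. z $ i) * (\<Prod>i | x $ i = 0. 1 - z $ i))"

definition penalty :: "real ^ 'n \<Rightarrow> real ^ 'n \<Rightarrow> real" where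
  "penalty x z = 1 \<bullet> x + 1 \<bullet> z - 2 * (x \<bullet> z)"

definition L_p :: "(real ^ 'n \<Rightarrow> real) \<Rightarrow> real ^ 'n \<Rightarrow> real \<Rightarrow> real" where
  "L_p \<phi> x \<rho> = (GREATEST v. \<exists>z \<in> cbox 0 1. v = psi \<phi> z - \<rho> * penalty x z)"

definition L_l :: "(real ^ 'n \<Rightarrow> real) \<Rightarrow> real ^ 'n \<Rightarrow> real ^ 'n \<Rightarrow> real" where
  "L_l \<phi> x l = (GREATEST v. \<exists>z \<in> cbox 0 1. v = psi \<phi> z - l \<bullet> (x - z))"

definition L_a :: "(real ^ 'n \<Rightarrow> real) \<Rightarrow> real ^ 'n \<Rightarrow> real ^ 'n \<Rightarrow> real \<Rightarrow> real" where
  "L_a \<phi> x l \<rho> = (GREATEST v. \<exists>z \<in> cbox 0 1. v = psi \<phi> z - l \<bullet> (x - z) - \<rho> * penalty x z)"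

(* The inequality d \<bullet> y \<ge> r x, as an inequality for d \<bullet> y \<ge> \<phi> x. *)

definition valid_and_tight :: "(real ^ 'n \<Rightarrow> real) \<Rightarrow> (real ^ 'n \<Rightarrow> real) \<Rightarrow> bool" where
  "valid_and_tight \<phi> r \<longleftrightarrow> (\<forall>x \<in> binary_cube. r x \<le> \<phi> x) \<and> (\<exists>x \<in> binary_cube. r x = \<phi> x)"

definition rho_hat :: "(real ^ 'n \<Rightarrow> real) \<Rightarrow> real" where
  "rho_hat \<phi> = Max {\<phi> z - \<phi> z' | z z'. z \<in> binary_cube \<and> z' \<in> binary_cube \<and> (norm (z - z'))\<^sup>2 = 1}"

definition flip_diffs :: "(real ^ 'n \<Rightarrow> real) \<Rightarrow> 'n \<Rightarrow> real set" where
  "flip_diffs \<phi> i = {\<phi> z - \<phi> z' | z z'. z \<in> binary_cube \<and> z' \<in> binary_cube \<and>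
     (\<forall>j. j \<noteq> i \<longrightarrow> z $ j = z' $ j) \<and> z $ i = 0 \<and> z' $ i = 1}"

definition lower_coeff :: "(real ^ 'n \<Rightarrow> real) \<Rightarrow> real ^ 'n" where
  "lower_coeff \<phi> = (\<chi> i. Min (flip_diffs \<phi> i))"

definition upper_coeff :: "(real ^ 'n \<Rightarrow> real) \<Rightarrow> real ^ 'n" where
  "upper_coeff \<phi> = (\<chi> i. Max (flip_diffs \<phi> i))"

definition aug_lower_coeff :: "(real ^ 'n \<Rightarrow> real) \<Rightarrow> real \<Rightarrow> real ^ 'n" where
  "aug_lower_coeff \<phi> r = (\<chi> i. r + Min (flip_diffs \<phi> i))"

definition aug_upper_coeff :: "(real ^ 'n \<Rightarrow> real) \<Rightarrow> real \<Rightarrow> real ^ 'n" where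
  "aug_upper_coeff \<phi> r = (\<chi> i. - r + Max (flip_diffs \<phi> i))"

definition lambda_hat :: "real ^ 'n \<Rightarrow> real ^ 'n \<Rightarrow> real ^ 'n \<Rightarrow> real ^ 'n" where
  "lambda_hat U L z = U * (1 - z) + L * z"

definition admissible_multiplier :: "real ^ 'n \<Rightarrow> real ^ 'n \<Rightarrow> real ^ 'n \<Rightarrow> real ^ 'n \<Rightarrow> bool" where
  "admissible_multiplier U L x l \<longleftrightarrow>
     (\<forall>i. (x $ i = 1 \<longrightarrow> l $ i \<ge> U $ i) \<and> (x $ i = 0 \<longrightarrow> l $ i \<le> L $ i))"

end

theory Submission
  imports Defs
begin

text \<open>
  For binary \<open>x\<close>, all three Lagrangians penalise moving coordinate \<open>i\<close> away from \<open>x\<close> by an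
  amount that dominates the largest gain in \<open>\<phi>\<close> from flipping that coordinate; flipping the
  differing coordinates one at a time shows that no binary \<open>z\<close> beats \<open>z = x\<close>. Since \<open>psi \<phi> z\<close>
  is the expectation of \<open>\<phi>\<close> under independent Bernoulli variables with means \<open>z $ i\<close>, and the
  penalty terms are affine in \<open>z\<close>, the bound extends to the whole unit cube. The penalty and
  Lagrangian cases are the instances \<open>l = 0\<close> and \<open>\<rho> = 0\<close> of the augmented one.
\<close>

section \<open>Sums over the vertices of the cube and the multilinear extension\<close>

lemma binary_cube_eq_image:
  "(binary_cube :: (real ^ 'n) set) = (\<lambda>f. \<chi> i. f i) ` (UNIV \<rightarrow>\<^sub>E {0, 1})"
proof (intro subset_antisym subsetI)
  fix x :: "real ^ 'n"
  assume "x \<in> binary_cube"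
  then have "($) x \<in> UNIV \<rightarrow>\<^sub>E {0, 1}" "x = (\<chi> i. x $ i)"
    by (auto simp: binary_cube_def vec_eq_iff)
  then show "x \<in> (\<lambda>f. \<chi> i. f i) ` (UNIV \<rightarrow>\<^sub>E {0, 1})" by blast
qed (auto simp: binary_cube_def PiE_def Pi_def)

lemma finite_binary_cube: "finite (binary_cube :: (real ^ 'n) set)"
  unfolding binary_cube_eq_image by (intro finite_imageI finite_PiE) auto

text \<open>Distributive law: expanding the product on the right chooses 0 or 1 in each coordinate,
  and the choices are exactly the vertices. Viewing vertices as functions makes
  \<open>prod_sum_PiE\<close> applicable.\<close>

lemma sum_binary_cube_prod:
  fixes f :: "'n::finite \<Rightarrow> real \<Rightarrow> real"
  shows "(\<Sum>x\<in>binary_cube. \<Prod>i\<in>UNIV. f i (x $ i)) = (\<Prod>i\<in>UNIV. f i 0 + f i 1)"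
proof -
  have "inj_on (\<lambda>f. \<chi> i. f i) (UNIV \<rightarrow>\<^sub>E {0, 1 :: real} :: ('n \<Rightarrow> real) set)"
    by (auto simp: inj_on_def vec_eq_iff)
  then have "(\<Sum>x\<in>binary_cube. \<Prod>i\<in>UNIV. f i (x $ i)) =
      (\<Sum>g\<in>UNIV \<rightarrow>\<^sub>E {0, 1}. \<Prod>i\<in>UNIV. f i (g i))"
    unfolding binary_cube_eq_image by (simp add: sum.reindex)
  also have "\<dots> = (\<Prod>i\<in>UNIV. \<Sum>t\<in>{0, 1}. f i t)"
    by (rule prod_sum_PiE[symmetric]) auto
  finally show ?thesis by simp
qed

text \<open>For \<open>z\<close> in the unit cube, the probability of \<open>x\<close> under
  independent Bernoulli coordinates with means \<open>z $ i\<close>. The \<open>if\<close> merges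
  the two products of \<open>psi\<close> into one over all coordinates, the shape needed for
  \<open>sum_binary_cube_prod\<close>.\<close>

definition vertex_weight :: "real ^ 'n \<Rightarrow> real ^ 'n \<Rightarrow> real" where
  "vertex_weight z x = (\<Prod>i\<in>UNIV. if x $ i = 1 then z $ i else 1 - z $ i)"

lemma psi_eq_sum_vertex_weight:
  fixes z :: "real ^ 'n"
  shows "psi \<phi> z = (\<Sum>x\<in>binary_cube. \<phi> x * vertex_weight z x)"
  unfolding psi_def
proof (rule sum.cong)
  fix x :: "real ^ 'n"
  assume "x \<in> binary_cube"
  then have "- {i. x $ i = 1} = {i. x $ i = 0}"
    by (auto simp: binary_cube_def)
  then show "\<phi> x * (\<Prod>i | x $ i = 1. z $ i) * (\<Prod>i | x $ i = 0. 1 - z $ i)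
      = \<phi> x * vertex_weight z x"
    by (simp add: vertex_weight_def prod.If_cases)
qed simp

lemma vertex_weight_nonneg:
  assumes "z \<in> cbox 0 1"
  shows "0 \<le> vertex_weight z x"
  using assms unfolding vertex_weight_def mem_box_cart by (intro prod_nonneg) auto

lemma sum_vertex_weight: "(\<Sum>x\<in>binary_cube. vertex_weight z x) = 1"
  unfolding vertex_weight_def
  by (subst sum_binary_cube_prod[of "\<lambda>i t. if t = 1 then z $ i else 1 - z $ i"]) simp

text \<open>The factor \<open>x $ j\<close> is absorbed into the \<open>j\<close>-th factor of the
  weight, so the sum still factorises: factor \<open>j\<close> contributes \<open>z $ j\<close> and
  every other factor contributes 1.\<close>

lemma sum_vertex_weight_coord:
  fixes z :: "real ^ 'n"
  shows "(\<Sum>x\<in>binary_cube. x $ j * vertex_weight z x) = z $ j"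
proof -
  define f where "f i t = (if t = 1 then z $ i else 1 - z $ i) * (if i = j then t else 1)"
    for i and t :: real
  have "x $ j * vertex_weight z x = (\<Prod>i\<in>UNIV. f i (x $ i))" for x
    unfolding f_def vertex_weight_def by (simp add: prod.distrib)
  then have "(\<Sum>x\<in>binary_cube. x $ j * vertex_weight z x) = (\<Prod>i\<in>UNIV. f i 0 + f i 1)"
    by (simp add: sum_binary_cube_prod)
  also have "\<dots> = (\<Prod>i\<in>UNIV. if i = j then z $ i else 1)"
    by (intro prod.cong) (auto simp: f_def)
  finally show ?thesis by simp
qed

lemma sum_vertex_weight_affine:
  fixes z b :: "real ^ 'n"
  shows "(\<Sum>x\<in>binary_cube. (a + b \<bullet> x) * vertex_weight z x) = a + b \<bullet> z"
proof -
  have "(\<Sum>x\<in>binary_cube. (b \<bullet> x) * vertex_weight z x)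
      = (\<Sum>x\<in>binary_cube. \<Sum>i\<in>UNIV. b $ i * (x $ i * vertex_weight z x))"
    by (simp add: inner_vec_def sum_distrib_right mult.assoc)
  also have "\<dots> = (\<Sum>i\<in>UNIV. b $ i * (\<Sum>x\<in>binary_cube. x $ i * vertex_weight z x))"
    by (subst sum.swap) (simp add: sum_distrib_left)
  also have "\<dots> = b \<bullet> z"
    by (simp add: sum_vertex_weight_coord inner_vec_def)
  finally show ?thesis
    by (simp add: distrib_right sum.distrib sum_vertex_weight flip: sum_distrib_left)
qed

text \<open>Average the vertex inequalities with the nonnegative weights; an affine function is
  reproduced exactly by this averaging.\<close>

lemma psi_le_affine:
  assumes "\<And>x. x \<in> binary_cube \<Longrightarrow> \<phi> x \<le> a + b \<bullet> x" and "z \<in> cbox 0 1"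
  shows "psi \<phi> z \<le> a + b \<bullet> z"
  unfolding psi_eq_sum_vertex_weight
  by (subst sum_vertex_weight_affine[symmetric])
    (intro sum_mono mult_right_mono assms vertex_weight_nonneg)

text \<open>At a vertex the weights form a point mass: a coordinate where \<open>y\<close> differs
  from \<open>x\<close> gives a zero factor.\<close>

lemma psi_eq_on_binary_cube:
  fixes x :: "real ^ 'n"
  assumes "x \<in> binary_cube"
  shows "psi \<phi> x = \<phi> x"
proof -
  have "vertex_weight x y = (if y = x then 1 else 0)" if "y \<in> binary_cube" for y
  proof (cases "y = x")
    case True
    then show ?thesis
      using assms unfolding vertex_weight_def binary_cube_def by (auto intro!: prod.neutral)
  next
    case False
    then obtain i where "y $ i \<noteq> x $ i" by (auto simp: vec_eq_iff)
    then have "(if y $ i = 1 then x $ i else 1 - x $ i) = 0"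
      using assms that unfolding binary_cube_def by (smt (verit) mem_Collect_eq)
    then have "vertex_weight x y = 0"
      unfolding vertex_weight_def by (intro prod_zero bexI[of _ i]) simp_all
    with False show ?thesis by simp
  qed
  then have "psi \<phi> x = (\<Sum>y\<in>binary_cube. if y = x then \<phi> y else 0)"
    unfolding psi_eq_sum_vertex_weight by (intro sum.cong) auto
  then show ?thesis
    using assms by (simp add: finite_binary_cube)
qed

section \<open>Exchange argument on the vertices and evaluation of the Lagrangians\<close>

lemma penalty_self:
  assumes "x \<in> binary_cube"
  shows "penalty x x = 0"
proof -
  have sq: "x $ i * x $ i = x $ i" for i
    using assms unfolding binary_cube_def by (smt (verit) mem_Collect_eq mult_cancel_left1 mult_zero_left)
  have "x \<bullet> x = 1 \<bullet> x"
    by (simp only: inner_vec_def inner_real_def one_index mult_1_left sq)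
  then show ?thesis by (simp add: penalty_def)
qed

text \<open>A common sufficient condition for all three cases. Leaving \<open>x $ i = 1\<close>
  gains \<open>t\<close> and costs \<open>l $ i + \<rho>\<close>; leaving \<open>x $ i = 0\<close>
  gains \<open>- t\<close> and costs \<open>\<rho> - l $ i\<close>.\<close>

definition dominates_flips :: "(real ^ 'n \<Rightarrow> real) \<Rightarrow> real ^ 'n \<Rightarrow> real ^ 'n \<Rightarrow> real \<Rightarrow> bool" where
  "dominates_flips \<phi> x l \<rho> \<longleftrightarrow> (\<forall>i. \<forall>t\<in>flip_diffs \<phi> i.
     (x $ i = 1 \<longrightarrow> t \<le> l $ i + \<rho>) \<and> (x $ i = 0 \<longrightarrow> l $ i - \<rho> \<le> t))"

text \<open>Induction on the Hamming distance from \<open>z\<close> to \<open>x\<close>: resetting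
  one differing coordinate to its value in \<open>x\<close> never decreases the left-hand side.
  Since \<open>flip_diffs\<close> ranges over all edges in direction \<open>i\<close>, the
  hypothesis applies at every intermediate vertex.\<close>

lemma vertex_bound:
  fixes x z :: "real ^ 'n"
  assumes dom: "dominates_flips \<phi> x l \<rho>" and x: "x \<in> binary_cube" and "z \<in> binary_cube"
  shows "\<phi> z - l \<bullet> (x - z) - \<rho> * penalty x z \<le> \<phi> x"
  using \<open>z \<in> binary_cube\<close>
proof (induction "card {i. z $ i \<noteq> x $ i}" arbitrary: z rule: less_induct)
  case less
  show ?case
  proof (cases "z = x")
    case True
    then show ?thesis using x by (simp add: penalty_self)
  next
    case False
    then obtain i where i: "z $ i \<noteq> x $ i" by (auto simp: vec_eq_iff)
    define w where "w = z + axis i (x $ i - z $ i)"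
    have w_nth: "w $ j = (if j = i then x $ i else z $ j)" for j
      by (simp add: w_def axis_def)
    then have w: "w \<in> binary_cube"
      using x less.prems by (auto simp: binary_cube_def)
    have "{j. w $ j \<noteq> x $ j} \<subset> {j. z $ j \<noteq> x $ j}"
      using i by (auto simp: w_nth)
    then have IH: "\<phi> w - l \<bullet> (x - w) - \<rho> * penalty x w \<le> \<phi> x"
      using less.hyps w by (simp add: psubset_card_mono)
    have l_w: "l \<bullet> (x - w) = l \<bullet> (x - z) - l $ i * (x $ i - z $ i)"
      by (simp add: w_def inner_diff_right inner_add_right inner_axis)
    \<comment> \<open>The added term equals -1 in both cases below, because on vertices the penalty
      counts the differing coordinates.\<close>
    have penalty_w: "penalty x w = penalty x z + (1 - 2 * x $ i) * (x $ i - z $ i)"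
      by (simp add: w_def penalty_def inner_add_right inner_axis algebra_simps)
    from x less.prems i consider "x $ i = 1" "z $ i = 0" | "x $ i = 0" "z $ i = 1"
      unfolding binary_cube_def by (smt (verit) mem_Collect_eq)
    then show ?thesis
    proof cases
      case 1
      then have "\<phi> z - \<phi> w \<in> flip_diffs \<phi> i"
        using w less.prems unfolding flip_diffs_def by (force simp: w_nth)
      then have "\<phi> z - \<phi> w \<le> l $ i + \<rho>"
        using dom 1 by (auto simp: dominates_flips_def)
      moreover have "l \<bullet> (x - w) + \<rho> * penalty x w
          = l \<bullet> (x - z) + \<rho> * penalty x z - (l $ i + \<rho>)"
        unfolding l_w penalty_w using 1 by (simp add: distrib_left right_diff_distrib)
      ultimately show ?thesis using IH by linarith
    next
      case 2
      then have "\<phi> w - \<phi> z \<in> flip_diffs \<phi> i"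
        using w less.prems unfolding flip_diffs_def by (force simp: w_nth)
      then have "l $ i - \<rho> \<le> \<phi> w - \<phi> z"
        using dom 2 by (auto simp: dominates_flips_def)
      moreover have "l \<bullet> (x - w) + \<rho> * penalty x w
          = l \<bullet> (x - z) + \<rho> * penalty x z + (l $ i - \<rho>)"
        unfolding l_w penalty_w using 2 by (simp add: distrib_left right_diff_distrib)
      ultimately show ?thesis using IH by linarith
    qed
  qed
qed

lemma L_a_eq:
  fixes x :: "real ^ 'n"
  assumes dom: "dominates_flips \<phi> x l \<rho>" and x: "x \<in> binary_cube"
  shows "L_a \<phi> x l \<rho> = \<phi> x"
  unfolding L_a_def
proof (rule Greatest_equality)
  \<comment> \<open>The maximum is attained at \<open>z = x\<close>, where both penalty terms
    vanish.\<close>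
  have "x $ i \<in> {0..1}" for i
    using x unfolding binary_cube_def by (smt (verit) atLeastAtMost_iff mem_Collect_eq)
  then have "x \<in> cbox 0 1" by (simp add: mem_box_cart)
  then show "\<exists>z\<in>cbox 0 1. \<phi> x = psi \<phi> z - l \<bullet> (x - z) - \<rho> * penalty x z"
    using x by (intro bexI[of _ x]) (simp_all add: psi_eq_on_binary_cube penalty_self)
next
  fix v
  assume "\<exists>z\<in>cbox 0 1. v = psi \<phi> z - l \<bullet> (x - z) - \<rho> * penalty x z"
  then obtain z where z: "z \<in> cbox 0 1" and v: "v = psi \<phi> z - l \<bullet> (x - z) - \<rho> * penalty x z"
    by blast
  \<comment> \<open>For fixed \<open>x\<close>, the upper bound on \<open>psi\<close> is affine in
    the second argument; \<open>a\<close> is its constant term and \<open>b\<close> its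
    gradient.\<close>
  define a where "a = \<phi> x + l \<bullet> x + \<rho> * (1 \<bullet> x)"
  define b where "b = \<rho> *\<^sub>R (1 - 2 *\<^sub>R x) - l"
  have affine: "\<phi> x + l \<bullet> (x - y) + \<rho> * penalty x y = a + b \<bullet> y" for y
    by (simp add: a_def b_def penalty_def inner_diff_left inner_diff_right algebra_simps)
  have "psi \<phi> z \<le> a + b \<bullet> z"
    using vertex_bound[OF dom x] z
    by (intro psi_le_affine) (auto simp: algebra_simps simp flip: affine)
  then show "v \<le> \<phi> x" by (simp add: v flip: affine)
qed

section \<open>Sufficiency of the concrete coefficients\<close>

lemma L_p_eq_L_a: "L_p \<phi> x \<rho> = L_a \<phi> x 0 \<rho>"
  by (simp add: L_p_def L_a_def)

lemma L_l_eq_L_a: "L_l \<phi> x l = L_a \<phi> x l 0"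
  by (simp add: L_l_def L_a_def)

lemma finite_flip_diffs: "finite (flip_diffs \<phi> i)"
proof (rule finite_subset)
  show "flip_diffs \<phi> i \<subseteq> (\<lambda>(z, z'). \<phi> z - \<phi> z') ` (binary_cube \<times> binary_cube)"
    by (force simp: flip_diffs_def)
qed (simp add: finite_binary_cube)

text \<open>With \<open>l = 0\<close> both \<open>t\<close> and \<open>- t\<close> must be at most
  \<open>\<rho>\<close>. The set under the maximum contains each pair of adjacent vertices in both
  orders, so \<open>rho_hat\<close> bounds both signs.\<close>

lemma dominates_flips_rho_hat:
  fixes \<phi> :: "real ^ 'n \<Rightarrow> real"
  assumes "rho_hat \<phi> \<le> \<rho>"
  shows "dominates_flips \<phi> x 0 \<rho>"
proof -
  let ?D = "{\<phi> z - \<phi> z' | z z'. z \<in> binary_cube \<and> z' \<in> binary_cube \<and> (norm (z - z'))\<^sup>2 = 1}"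
  have "?D \<subseteq> (\<lambda>(z, z'). \<phi> z - \<phi> z') ` (binary_cube \<times> binary_cube)" by force
  then have fin: "finite ?D"
    by (rule finite_subset) (simp add: finite_binary_cube)
  have "t \<le> \<rho> \<and> - t \<le> \<rho>" if "t \<in> flip_diffs \<phi> i" for t i
  proof -
    from that obtain z z' where z: "z \<in> binary_cube" "z' \<in> binary_cube" "t = \<phi> z - \<phi> z'"
      and "\<forall>j. j \<noteq> i \<longrightarrow> z $ j = z' $ j" "z $ i = 0" "z' $ i = 1"
      by (auto simp: flip_diffs_def)
    then have "z' - z = axis i 1" by (auto simp: vec_eq_iff axis_def)
    then have "norm (z' - z) = 1" by (simp add: norm_axis_1)
    then have "(norm (z - z'))\<^sup>2 = 1" "(norm (z' - z))\<^sup>2 = 1"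
      by (simp_all add: norm_minus_commute)
    with z have "\<phi> z - \<phi> z' \<in> ?D" "\<phi> z' - \<phi> z \<in> ?D" by blast+
    with fin have "\<phi> z - \<phi> z' \<le> rho_hat \<phi>" "\<phi> z' - \<phi> z \<le> rho_hat \<phi>"
      unfolding rho_hat_def by (auto intro: Max_ge)
    with assms z(3) show ?thesis by linarith
  qed
  then show ?thesis unfolding dominates_flips_def by fastforce
qed

text \<open>The shift by \<open>\<rho>0\<close> in the coefficients is paid back by the penalty
  \<open>\<rho>\<close>; any excess of \<open>\<rho>\<close> over \<open>\<rho>0\<close> only adds
  slack.\<close>

lemma dominates_flips_aug:
  assumes "admissible_multiplier (aug_upper_coeff \<phi> \<rho>0) (aug_lower_coeff \<phi> \<rho>0) x l" "\<rho>0 \<le> \<rho>"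
  shows "dominates_flips \<phi> x l \<rho>"
  unfolding dominates_flips_def
proof (intro allI ballI)
  fix i t
  assume "t \<in> flip_diffs \<phi> i"
  then have "Min (flip_diffs \<phi> i) \<le> t" "t \<le> Max (flip_diffs \<phi> i)"
    by (simp_all add: finite_flip_diffs)
  then show "(x $ i = 1 \<longrightarrow> t \<le> l $ i + \<rho>) \<and> (x $ i = 0 \<longrightarrow> l $ i - \<rho> \<le> t)"
    using assms
    by (fastforce simp: admissible_multiplier_def aug_upper_coeff_def aug_lower_coeff_def)
qed

lemma upper_coeff_eq_aug: "upper_coeff \<phi> = aug_upper_coeff \<phi> 0"
  by (simp add: upper_coeff_def aug_upper_coeff_def)

lemma lower_coeff_eq_aug: "lower_coeff \<phi> = aug_lower_coeff \<phi> 0"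
  by (simp add: lower_coeff_def aug_lower_coeff_def)

section \<open>Validity and tightness of the inequalities\<close>

lemma admissible_multiplier_lambda_hat:
  "admissible_multiplier U L x (lambda_hat U L (1 - x))"
  by (simp add: admissible_multiplier_def lambda_hat_def)

text \<open>Where two vertices \<open>x\<close> and \<open>z\<close> differ, \<open>z\<close> agrees with \<open>1 - x\<close>.\<close>

lemma lambda_hat_inner_complement:
  assumes "x \<in> binary_cube" "z \<in> binary_cube"
  shows "lambda_hat U L (1 - x) \<bullet> (x - z) = lambda_hat U L z \<bullet> (x - z)"
proof -
  have "lambda_hat U L (1 - x) $ i * (x $ i - z $ i) = lambda_hat U L z $ i * (x $ i - z $ i)" for i
  proof -
    have "x $ i = z $ i \<or> z $ i = 1 - x $ i"
      using assms unfolding binary_cube_def by (smt (verit) mem_Collect_eq)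
    then show ?thesis by (auto simp: lambda_hat_def)
  qed
  then show ?thesis by (simp only: inner_vec_def vector_minus_component inner_real_def)
qed

lemma cut_aug:
  fixes \<phi> :: "real ^ 'n \<Rightarrow> real" and \<rho> :: real
  assumes z: "z \<in> binary_cube"
  defines "r \<equiv> \<lambda>x. \<phi> z - lambda_hat (aug_upper_coeff \<phi> \<rho>) (aug_lower_coeff \<phi> \<rho>) z \<bullet> (x - z)
    - \<rho> * penalty x z"
  shows "valid_and_tight \<phi> r \<and> r z = \<phi> z"
proof -
  have tight: "r z = \<phi> z" using z by (simp add: r_def penalty_self)
  have "r x \<le> \<phi> x" if x: "x \<in> binary_cube" for x
    \<comment> \<open>Here \<open>x\<close> is the centre and \<open>z\<close> the competitor, so
      the multiplier must be admissible at \<open>x\<close>. The one built from \<open>1 - x\<close>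
      is: it picks \<open>U\<close> where \<open>x\<close> is 1 and \<open>L\<close> where
      \<open>x\<close> is 0. Its inner product with \<open>x - z\<close> agrees with that of the
      multiplier built from \<open>z\<close>.\<close>
    using vertex_bound[OF dominates_flips_aug[OF admissible_multiplier_lambda_hat order_refl] x z]
    by (simp add: r_def lambda_hat_inner_complement[OF x z])
  with z tight show ?thesis unfolding valid_and_tight_def by blast
qed

lemma cut_penalty:
  fixes \<phi> :: "real ^ 'n \<Rightarrow> real"
  assumes z: "z \<in> binary_cube"
  defines "r \<equiv> \<lambda>x. \<phi> z - rho_hat \<phi> * penalty x z"
  shows "valid_and_tight \<phi> r \<and> r z = \<phi> z"
proof -
  have tight: "r z = \<phi> z" using z by (simp add: r_def penalty_self)
  have "r x \<le> \<phi> x" if x: "x \<in> binary_cube" for x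
    using vertex_bound[OF dominates_flips_rho_hat[OF order_refl] x z] by (simp add: r_def)
  with z tight show ?thesis unfolding valid_and_tight_def by blast
qed

theorem proposition4:
  fixes Y :: "(real ^ 'y) set" and d :: "real ^ 'y"
    and A :: "real ^ 'n ^ 'm" and B :: "real ^ 'y ^ 'm" and h :: "real ^ 'm"
    and \<phi> :: "real ^ 'n \<Rightarrow> real"
  assumes "real_valued_value_fn Y d A B h"
    and "\<phi> = value_fn Y d A B h"
  shows
    "((\<forall>x\<in>binary_cube. \<forall>\<rho>. \<rho> \<ge> rho_hat \<phi> \<longrightarrow> \<phi> x = L_p \<phi> x \<rho>) \<and>
      (\<forall>z\<in>binary_cube. let r = (\<lambda>x. \<phi> z - rho_hat \<phi> * penalty x z)
         in valid_and_tight \<phi> r \<and> r z = \<phi> z))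
   \<and> (let L = lower_coeff \<phi>; U = upper_coeff \<phi> in
      (\<forall>x\<in>binary_cube. \<forall>l. admissible_multiplier U L x l \<longrightarrow> \<phi> x = L_l \<phi> x l) \<and>
      (\<forall>z\<in>binary_cube. let r = (\<lambda>x. \<phi> z - lambda_hat U L z \<bullet> (x - z))
         in valid_and_tight \<phi> r \<and> r z = \<phi> z))
   \<and> (\<forall>\<rho>0\<ge>0. let L = aug_lower_coeff \<phi> \<rho>0; U = aug_upper_coeff \<phi> \<rho>0 in
      (\<forall>x\<in>binary_cube. \<forall>\<rho> l. \<rho> \<ge> \<rho>0 \<longrightarrow> admissible_multiplier U L x l \<longrightarrow> \<phi> x = L_a \<phi> x l \<rho>) \<and>
      (\<forall>z\<in>binary_cube. let r = (\<lambda>x. \<phi> z - lambda_hat U L z \<bullet> (x - z) - \<rho>0 * penalty x z)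
         in valid_and_tight \<phi> r \<and> r z = \<phi> z))"
proof (intro conjI)
  show "\<forall>x\<in>binary_cube. \<forall>\<rho>. \<rho> \<ge> rho_hat \<phi> \<longrightarrow> \<phi> x = L_p \<phi> x \<rho>"
    by (simp add: L_p_eq_L_a L_a_eq dominates_flips_rho_hat)
  show "\<forall>z\<in>binary_cube. let r = (\<lambda>x. \<phi> z - rho_hat \<phi> * penalty x z)
         in valid_and_tight \<phi> r \<and> r z = \<phi> z"
    using cut_penalty unfolding Let_def by blast
  show "let L = lower_coeff \<phi>; U = upper_coeff \<phi> in
      (\<forall>x\<in>binary_cube. \<forall>l. admissible_multiplier U L x l \<longrightarrow> \<phi> x = L_l \<phi> x l) \<and>
      (\<forall>z\<in>binary_cube. let r = (\<lambda>x. \<phi> z - lambda_hat U L z \<bullet> (x - z))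
         in valid_and_tight \<phi> r \<and> r z = \<phi> z)"
    \<comment> \<open>At \<open>\<rho>0 = \<rho> = 0\<close> the augmented coefficients are
      \<open>L\<close> and \<open>U\<close>, and the penalty term disappears from the
      inequality.\<close>
    using dominates_flips_aug[of \<phi> 0 _ _ 0] cut_aug[of _ \<phi> 0]
    by (simp add: Let_def upper_coeff_eq_aug lower_coeff_eq_aug L_l_eq_L_a L_a_eq)
  show "\<forall>\<rho>0\<ge>0. let L = aug_lower_coeff \<phi> \<rho>0; U = aug_upper_coeff \<phi> \<rho>0 in
      (\<forall>x\<in>binary_cube. \<forall>\<rho> l. \<rho> \<ge> \<rho>0 \<longrightarrow> admissible_multiplier U L x l \<longrightarrow> \<phi> x = L_a \<phi> x l \<rho>) \<and>
      (\<forall>z\<in>binary_cube. let r = (\<lambda>x. \<phi> z - lambda_hat U L z \<bullet> (x - z) - \<rho>0 * penalty x z)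
         in valid_and_tight \<phi> r \<and> r z = \<phi> z)"
    using cut_aug[of _ \<phi>] by (simp add: Let_def L_a_eq dominates_flips_aug)
qed

end
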